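(* Let $N\ge 2$ and let $[f]:S^2=\mathbb{C}\cup\{\infty\}\to\mathbb{C}P^{N-1}$ be a smooth map, represented on $\mathbb{C}$ by a smooth map $f:\mathbb{C}\to\mathbb{C}^N\setminus\{0\}$. Put $P=I_N-\frac{f f^\dagger}{f^\dagger f}$. Assume that $[f]$ is a solution of the $\mathbb{C}P^{N-1}$ sigma model equations, i.e. $\partial[\bar\partial P,P]+\bar\partial[\partial P,P]=0$, and that its action $S$ is finite. Then the functions $$J=\frac{1}{f^\dagger f}\,(\partial f^\dagger)\,P\,(\partial f),\qquad \bar J=\frac{1}{f^\dagger f}\,(\bar\partial f^\dagger)\,P\,(\bar\partial f)$$ vanish identically on $\mathbb{C}$. Consequently the surface given by the generalized Weierstrass formula $X:\mathbb{C}\to su(N)$, $dX=i\left(-[\partial P,P]\,d\xi+[\bar\partial P,P]\,d\bar\xi\right)$, is conformally parametrized: $\langle\partial X,\partial X\rangle=\langle\bar\partial X,\bar\partial X\rangle=0$, i.e. its first fundamental form has no $d\xi^2$ and no $d\bar\xi^2$ terms.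
   Context: $\xi=\xi^1+i\xi^2$ is the coordinate on $\mathbb{C}$, $\partial=\frac12(\partial_{\xi^1}-i\partial_{\xi^2})$, $\bar\partial=\frac12(\partial_{\xi^1}+i\partial_{\xi^2})$; $\dagger$ is Hermitian conjugation; $\partial f^\dagger$ means $\partial(f^\dagger)$ (so $\partial f^\dagger=(\bar\partial f)^\dagger$). With $z=f/(f^\dagger f)^{1/2}$ and $D_\mu z=\partial_{\xi^\mu}z-(z^\dagger\partial_{\xi^\mu}z)z$ ($\mu=1,2$), the action is $S=\frac14\int_{\mathbb{C}}\sum_{\mu}(D_\mu z)^\dagger(D_\mu z)\,d\xi\,d\bar\xi$ (integration with respect to the area measure of the plane), and the displayed equation for $P$ is its Euler–Lagrange equation. That equation says that the $su(N)$-valued 1-form $i(-[\partial P,P]d\xi+[\bar\partial P,P]d\bar\xi)$ is closed, so $X$ exists on $\mathbb{C}$ and is unique up to an additive constant. $su(N)$ (traceless anti-Hermitian matrices) is identified with Euclidean $\mathbb{R}^{N^2-1}$ via $\langle A,B\rangle=-\frac12\mathrm{tr}(AB)$, extended complex-bilinearly to the complexification. *)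

theory Defs
  imports "HOL-Analysis.Analysis"
begin

section \<open>Smooth maps, the Riemann sphere and complex projective space\<close>

text \<open>For open \<open>S\<close>: \<open>f\<close> is \<open>k\<close> times continuously differentiable (over the reals) on \<open>S\<close>.\<close>

primrec Ck_on :: "nat \<Rightarrow> 'a::real_normed_vector set \<Rightarrow> ('a \<Rightarrow> 'b::real_normed_vector) \<Rightarrow> bool" where
  "Ck_on 0 S f \<longleftrightarrow> continuous_on S f"
| "Ck_on (Suc k) S f \<longleftrightarrow>
     (\<forall>x\<in>S. f differentiable (at x)) \<and> (\<forall>v. Ck_on k S (\<lambda>x. frechet_derivative f (at x) v))"

definition smooth_on :: "'a::real_normed_vector set \<Rightarrow> ('a \<Rightarrow> 'b::real_normed_vector) \<Rightarrow> bool" where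
  "smooth_on S f \<longleftrightarrow> (\<forall>k. Ck_on k S f)"

text \<open>With \<open>N = CARD('n)\<close>, points of \<open>CP\<^sup>N\<^sup>-\<^sup>1\<close> are the complex lines through the origin
  of \<open>complex ^ 'n\<close>.\<close>

definition cline :: "complex ^ 'n \<Rightarrow> (complex ^ 'n) set" where
  "cline v = vec.span {v}"

definition CP :: "(complex ^ 'n) set set" where
  "CP = {cline v | v. v \<noteq> 0}"

definition chart_dom :: "'n::finite \<Rightarrow> (complex ^ 'n) set set" where
  "chart_dom j = {L \<in> CP. \<exists>v\<in>L. v $ j \<noteq> 0}"

text \<open>The affine chart \<open>[v] \<mapsto> (v\<^sub>i / v\<^sub>j)\<^sub>i\<close>; the redundant coordinate \<open>i = j\<close>,
  constantly 1, is kept.\<close>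

definition affine_chart :: "'n::finite \<Rightarrow> (complex ^ 'n) set \<Rightarrow> complex ^ 'n" where
  "affine_chart j L = (THE v. v \<in> L \<and> v $ j = 1)"

definition smooth_map_CP :: "(complex \<Rightarrow> (complex ^ 'n) set) \<Rightarrow> bool" where
  "smooth_map_CP G \<longleftrightarrow> (\<forall>z. \<exists>j V. open V \<and> z \<in> V \<and> (\<forall>w\<in>V. G w \<in> chart_dom j) \<and>
     smooth_on V (\<lambda>w. affine_chart j (G w)))"

text \<open>\<open>S\<^sup>2\<close> is \<open>complex option\<close>, with \<open>None\<close> as the point at infinity; its two
  charts have the coordinates \<open>\<xi>\<close> and \<open>w = 1/\<xi>\<close>.\<close>

definition smooth_map_S2_CP :: "(complex option \<Rightarrow> (complex ^ 'n) set) \<Rightarrow> bool" where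
  "smooth_map_S2_CP F \<longleftrightarrow>
     smooth_map_CP (\<lambda>\<xi>. F (Some \<xi>)) \<and>
     smooth_map_CP (\<lambda>w. F (if w = 0 then None else Some (1 / w)))"

section \<open>Matrices and Wirtinger derivatives\<close>

definition scaleM :: "complex \<Rightarrow> complex ^ 'n ^ 'm \<Rightarrow> complex ^ 'n ^ 'm"  (infixr "*\<^sub>M" 75) where
  "c *\<^sub>M A = (\<chi> i j. c * A $ i $ j)"

text \<open>A row vector is also an element of \<open>complex ^ 'n\<close>; \<open>row_col\<close> is the (bilinear)
  product of a row with a column.\<close>

definition herm :: "complex ^ 'n \<Rightarrow> complex ^ 'n" where
  "herm v = (\<chi> i. cnj (v $ i))"

definition row_col :: "complex ^ 'n::finite \<Rightarrow> complex ^ 'n \<Rightarrow> complex" where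
  "row_col r v = (\<Sum>i\<in>UNIV. r $ i * v $ i)"

definition col_row :: "complex ^ 'n \<Rightarrow> complex ^ 'n \<Rightarrow> complex ^ 'n ^ 'n" where
  "col_row v r = (\<chi> i j. v $ i * r $ j)"

definition hermM :: "complex ^ 'n ^ 'm \<Rightarrow> complex ^ 'm ^ 'n" where
  "hermM A = (\<chi> i j. cnj (A $ j $ i))"

definition commutator :: "complex ^ 'n ^ 'n::finite \<Rightarrow> complex ^ 'n ^ 'n \<Rightarrow> complex ^ 'n ^ 'n" where
  "commutator A B = A ** B - B ** A"

definition su :: "(complex ^ 'n ^ 'n::finite) set" where
  "su = {A. hermM A = - A \<and> trace A = 0}"

definition su_form :: "complex ^ 'n ^ 'n::finite \<Rightarrow> complex ^ 'n ^ 'n \<Rightarrow> complex" where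
  "su_form A B = - (1 / 2) * trace (A ** B)"

text \<open>The partial derivatives with respect to \<open>\<xi>\<^sup>1\<close> and \<open>\<xi>\<^sup>2\<close> are the
  derivatives in the directions \<open>1\<close> and \<open>\<i>\<close>.\<close>

definition pd :: "complex \<Rightarrow> (complex \<Rightarrow> 'a::real_normed_vector) \<Rightarrow> complex \<Rightarrow> 'a" where
  "pd \<mu> g \<xi> = frechet_derivative g (at \<xi>) \<mu>"

definition dV :: "(complex \<Rightarrow> complex ^ 'n::finite) \<Rightarrow> complex \<Rightarrow> complex ^ 'n" where
  "dV g \<xi> = (1 / 2) *s (pd 1 g \<xi> - \<i> *s pd \<i> g \<xi>)"

definition dbarV :: "(complex \<Rightarrow> complex ^ 'n::finite) \<Rightarrow> complex \<Rightarrow> complex ^ 'n" where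
  "dbarV g \<xi> = (1 / 2) *s (pd 1 g \<xi> + \<i> *s pd \<i> g \<xi>)"

definition dM :: "(complex \<Rightarrow> complex ^ 'n::finite ^ 'm::finite) \<Rightarrow> complex \<Rightarrow> complex ^ 'n ^ 'm" where
  "dM G \<xi> = (1 / 2) *\<^sub>M (pd 1 G \<xi> - \<i> *\<^sub>M pd \<i> G \<xi>)"

definition dbarM :: "(complex \<Rightarrow> complex ^ 'n::finite ^ 'm::finite) \<Rightarrow> complex \<Rightarrow> complex ^ 'n ^ 'm" where
  "dbarM G \<xi> = (1 / 2) *\<^sub>M (pd 1 G \<xi> + \<i> *\<^sub>M pd \<i> G \<xi>)"

section \<open>The sigma model and its surface\<close>

definition projP :: "(complex \<Rightarrow> complex ^ 'n::finite) \<Rightarrow> complex \<Rightarrow> complex ^ 'n ^ 'n" where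
  "projP f \<xi> = mat 1 - (1 / row_col (herm (f \<xi>)) (f \<xi>)) *\<^sub>M col_row (f \<xi>) (herm (f \<xi>))"

definition sigma_model_eq :: "(complex \<Rightarrow> complex ^ 'n::finite) \<Rightarrow> bool" where
  "sigma_model_eq f \<longleftrightarrow> (\<forall>\<xi>.
     dM (\<lambda>\<zeta>. commutator (dbarM (projP f) \<zeta>) (projP f \<zeta>)) \<xi> +
     dbarM (\<lambda>\<zeta>. commutator (dM (projP f) \<zeta>) (projP f \<zeta>)) \<xi> = 0)"

definition normalized :: "(complex \<Rightarrow> complex ^ 'n::finite) \<Rightarrow> complex \<Rightarrow> complex ^ 'n" where
  "normalized f \<xi> = (1 / sqrt (Re (row_col (herm (f \<xi>)) (f \<xi>)))) *\<^sub>R f \<xi>"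

definition cov_deriv :: "complex \<Rightarrow> (complex \<Rightarrow> complex ^ 'n::finite) \<Rightarrow> complex \<Rightarrow> complex ^ 'n" where
  "cov_deriv \<mu> z \<xi> = pd \<mu> z \<xi> - row_col (herm (z \<xi>)) (pd \<mu> z \<xi>) *s z \<xi>"

definition action :: "(complex \<Rightarrow> complex ^ 'n::finite) \<Rightarrow> ennreal" where
  "action f = (1 / 4) * (\<integral>\<^sup>+ \<xi>. ennreal (Re (\<Sum>\<mu>\<in>{1, \<i>}.
     row_col (herm (cov_deriv \<mu> (normalized f) \<xi>)) (cov_deriv \<mu> (normalized f) \<xi>))) \<partial>lborel)"

definition J :: "(complex \<Rightarrow> complex ^ 'n::finite) \<Rightarrow> complex \<Rightarrow> complex" where
  "J f \<xi> = (1 / row_col (herm (f \<xi>)) (f \<xi>)) *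
     row_col (dV (\<lambda>\<zeta>. herm (f \<zeta>)) \<xi>) (projP f \<xi> *v dV f \<xi>)"

definition Jbar :: "(complex \<Rightarrow> complex ^ 'n::finite) \<Rightarrow> complex \<Rightarrow> complex" where
  "Jbar f \<xi> = (1 / row_col (herm (f \<xi>)) (f \<xi>)) *
     row_col (dbarV (\<lambda>\<zeta>. herm (f \<zeta>)) \<xi>) (projP f \<xi> *v dbarV f \<xi>)"

text \<open>A tangent vector \<open>h\<close> is evaluated by \<open>d\<xi>(h) = h\<close> and by the conjugate form as
  \<open>cnj h\<close>.\<close>

definition weierstrass_surface ::
    "(complex \<Rightarrow> complex ^ 'n::finite) \<Rightarrow> (complex \<Rightarrow> complex ^ 'n ^ 'n) \<Rightarrow> bool" where
  "weierstrass_surface f X \<longleftrightarrow> (\<forall>\<xi>. X \<xi> \<in> su) \<and>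
     (\<forall>\<xi>. (X has_derivative (\<lambda>h. \<i> *\<^sub>M
        (- (h *\<^sub>M commutator (dM (projP f) \<xi>) (projP f \<xi>)) +
         cnj h *\<^sub>M commutator (dbarM (projP f) \<xi>) (projP f \<xi>)))) (at \<xi>))"

definition first_fundamental_form ::
    "(complex \<Rightarrow> complex ^ 'n ^ 'n::finite) \<Rightarrow> complex \<Rightarrow> complex \<Rightarrow> complex" where
  "first_fundamental_form X \<xi> h =
     su_form (frechet_derivative X (at \<xi>) h) (frechet_derivative X (at \<xi>) h)"

end

theory Submission
  imports Defs "HOL-Complex_Analysis.Cauchy_Integral_Formula"
begin

text \<open>
  Put \<open>P = projP f\<close>. Differentiating \<open>P\<close> gives \<open>tr (\<partial>P \<partial>P) = 2 J\<close>, and the sigma model equation says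
  that the Laplacian of \<open>P\<close> commutes with \<open>P\<close>. As \<open>\<partial>P\<close> is off-diagonal with respect to \<open>P\<close>, the
  trace of its product with that Laplacian vanishes, so \<open>tr (\<partial>P \<partial>P)\<close> is entire. Smoothness of
  \<open>[f]\<close> at infinity makes it \<open>O(\<xi>\<^sup>-\<^sup>4)\<close>: it is a holomorphic quadratic differential on the sphere.
  By Liouville's theorem it is zero. The conjugate statement follows because \<open>P\<close> is Hermitian, and
  \<open>tr ([\<partial>P, P]\<^sup>2) = - tr (\<partial>P \<partial>P)\<close> turns it into conformality of the surface.
\<close>

section \<open>Calculus of continuously differentiable maps of the plane\<close>

lemma Ck_on_Suc_pd:
  "Ck_on (Suc k) UNIV f \<longleftrightarrow> (\<forall>x. f differentiable (at x)) \<and> (\<forall>v. Ck_on k UNIV (pd v f))"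
  by (simp add: pd_def[abs_def])

lemma has_derivative_pd:
  "f differentiable (at x) \<Longrightarrow> (f has_derivative (\<lambda>v. pd v f x)) (at x)"
  unfolding pd_def using frechet_derivative_works by auto

lemma pd_eqI: "(f has_derivative D) (at x) \<Longrightarrow> pd v f x = D v"
  by (metis frechet_derivative_at pd_def)

text \<open>Serves the closure lemmas below: an explicit derivative is written down first, and each
  of its directional values is then built from maps already known to be \<open>k\<close> times
  continuously differentiable.\<close>

lemma Ck_on_SucI:
  fixes f :: "complex \<Rightarrow> 'b::real_normed_vector"
  assumes D: "\<And>x. (f has_derivative D x) (at x)" and "\<And>v. Ck_on k UNIV (\<lambda>x. D x v)"
  shows "Ck_on (Suc k) UNIV f"
proof -
  have "pd v f = (\<lambda>x. D x v)" for v
    using pd_eqI[OF D] by blast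
  then show ?thesis
    unfolding Ck_on_Suc_pd using assms by (auto simp: differentiable_def)
qed

text \<open>The derivative is real-linear in the direction, so the values in the directions 1 and
  \<open>\<i>\<close> determine all others.\<close>

lemma pd_complex:
  assumes "f differentiable (at x)"
  shows "pd h f x = Re h *\<^sub>R pd 1 f x + Im h *\<^sub>R pd \<i> f x"
proof -
  interpret bounded_linear "\<lambda>v. pd v f x"
    using has_derivative_pd[OF assms] by (rule has_derivative_bounded_linear)
  have "h = Re h *\<^sub>R 1 + Im h *\<^sub>R \<i>"
    by (simp add: complex_eq_iff)
  then show ?thesis
    by (metis add scaleR)
qed

lemma Ck_on_imp_differentiable: "Ck_on (Suc k) UNIV f \<Longrightarrow> f differentiable (at x)"
  by simp

lemma Ck_on_SucD: "Ck_on (Suc k) S f \<Longrightarrow> Ck_on k S f"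
proof (induction k arbitrary: f)
  case 0
  then show ?case
    by (auto intro!: continuous_at_imp_continuous_on differentiable_imp_continuous_within)
next
  case (Suc k)
  then show ?case
    by (metis Ck_on.simps(2))
qed

lemma Ck_on_le: "Ck_on k S f \<Longrightarrow> j \<le> k \<Longrightarrow> Ck_on j S f"
  by (induction k) (metis le_zero_eq, metis Ck_on_SucD le_Suc_eq)

lemma Ck_on_imp_continuous: "Ck_on k S f \<Longrightarrow> continuous_on S f"
  using Ck_on_le[of k S f 0] by simp

lemma Ck_on_const: "Ck_on k UNIV (\<lambda>x. c)"
  by (induction k arbitrary: c) auto

lemma Ck_on_linear:
  fixes f :: "complex \<Rightarrow> 'b::real_normed_vector"
  assumes "bounded_linear L"
  shows "Ck_on k UNIV f \<Longrightarrow> Ck_on k UNIV (\<lambda>x. L (f x))"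
proof (induction k arbitrary: f)
  case 0
  then show ?case
    by (simp add: bounded_linear.continuous_on[OF assms])
next
  case (Suc k)
  have D: "((\<lambda>x. L (f x)) has_derivative (\<lambda>v. L (pd v f x))) (at x)" for x
    using Suc.prems by (intro bounded_linear.has_derivative[OF assms] has_derivative_pd) simp
  show ?case
    using Suc.prems by (intro Ck_on_SucI[OF D] Suc.IH) (simp_all add: pd_def[abs_def])
qed

lemma Ck_on_add:
  fixes f g :: "complex \<Rightarrow> 'b::real_normed_vector"
  shows "Ck_on k UNIV f \<Longrightarrow> Ck_on k UNIV g \<Longrightarrow> Ck_on k UNIV (\<lambda>x. f x + g x)"
proof (induction k arbitrary: f g)
  case 0
  then show ?case
    by (simp add: continuous_on_add)
next
  case (Suc k)
  have D: "((\<lambda>x. f x + g x) has_derivative (\<lambda>v. pd v f x + pd v g x)) (at x)" for x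
    using Suc.prems by (intro has_derivative_add has_derivative_pd) simp_all
  show ?case
    using Suc.prems by (intro Ck_on_SucI[OF D] Suc.IH) (simp_all add: pd_def[abs_def])
qed

lemma Ck_on_diff:
  fixes f g :: "complex \<Rightarrow> 'b::real_normed_vector"
  assumes "Ck_on k UNIV f" "Ck_on k UNIV g"
  shows "Ck_on k UNIV (\<lambda>x. f x - g x)"
  using Ck_on_add[OF assms(1) Ck_on_linear[OF bounded_linear_minus[OF bounded_linear_ident] assms(2)]]
  by simp

text \<open>One induction for every kind of product used later. The product rule leaves one factor
  undifferentiated; \<open>Ck_on_SucD\<close> lowers its order so that the induction hypothesis
  applies.\<close>

lemma Ck_on_bilinear:
  fixes f :: "complex \<Rightarrow> 'b::real_normed_vector" and g :: "complex \<Rightarrow> 'c::real_normed_vector"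
  assumes "bounded_bilinear p"
  shows "Ck_on k UNIV f \<Longrightarrow> Ck_on k UNIV g \<Longrightarrow> Ck_on k UNIV (\<lambda>x. p (f x) (g x))"
proof (induction k arbitrary: f g)
  case 0
  then show ?case
    by (simp add: bounded_bilinear.continuous_on[OF assms])
next
  case (Suc k)
  have D: "((\<lambda>x. p (f x) (g x)) has_derivative (\<lambda>v. p (f x) (pd v g x) + p (pd v f x) (g x))) (at x)" for x
    using Suc.prems by (intro bounded_bilinear.FDERIV[OF assms] has_derivative_pd) simp_all
  have "Ck_on k UNIV (\<lambda>x. p (f x) (pd v g x) + p (pd v f x) (g x))" for v
    using Suc.prems Ck_on_SucD[OF Suc.prems(1)] Ck_on_SucD[OF Suc.prems(2)]
    by (intro Ck_on_add Suc.IH) (simp_all add: pd_def[abs_def])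
  with D show ?case
    by (rule Ck_on_SucI)
qed

text \<open>The derivative of the reciprocal contains only the reciprocal itself and the derivative
  of \<open>g\<close>, so the induction hypothesis is needed for the same \<open>g\<close>
  only.\<close>

lemma Ck_on_inverse:
  fixes g :: "complex \<Rightarrow> complex"
  assumes nz: "\<And>x. g x \<noteq> 0"
  shows "Ck_on k UNIV g \<Longrightarrow> Ck_on k UNIV (\<lambda>x. inverse (g x))"
proof (induction k)
  case 0
  then show ?case
    using nz by (simp add: continuous_on_inverse)
next
  case (Suc k)
  have D: "((\<lambda>x. inverse (g x)) has_derivative (\<lambda>v. - (inverse (g x) * pd v g x * inverse (g x)))) (at x)" for x
    by (rule Deriv.has_derivative_inverse[OF nz has_derivative_pd[OF Ck_on_imp_differentiable[OF Suc.prems]]])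
  have "Ck_on k UNIV (\<lambda>x. - (inverse (g x) * pd v g x * inverse (g x)))" for v
    using Suc.prems Suc.IH[OF Ck_on_SucD[OF Suc.prems]]
    by (intro Ck_on_linear[OF bounded_linear_minus[OF bounded_linear_ident]]
        Ck_on_bilinear[OF bounded_bilinear_mult]) (simp_all add: pd_def[abs_def])
  with D show ?case
    by (rule Ck_on_SucI)
qed

section \<open>Integration along segments: symmetry of second derivatives and primitives of closed
  1-forms\<close>

lemma has_vector_derivative_line:
  assumes "f differentiable (at (x + t *\<^sub>R v))"
  shows "((\<lambda>t. f (x + t *\<^sub>R v)) has_vector_derivative pd v f (x + t *\<^sub>R v)) (at t within S)"
proof -
  have "((\<lambda>t. x + t *\<^sub>R v) has_derivative (\<lambda>s. s *\<^sub>R v)) (at t within S)"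
    by (auto intro!: derivative_eq_intros)
  from has_derivative_compose[OF this has_derivative_pd[OF assms]]
  show ?thesis
    unfolding has_vector_derivative_def
    using linear_scale[OF has_derivative_linear[OF has_derivative_pd[OF assms]]] by simp
qed

text \<open>Schwarz's theorem: differentiate the fundamental theorem of calculus along one direction under
  the integral sign in the other.\<close>

lemma pd_commute:
  fixes F :: "complex \<Rightarrow> 'b::banach"
  assumes "Ck_on 2 UNIV F"
  shows "pd b (pd a F) \<xi> = pd a (pd b F) \<xi>"
proof -
  have C: "Ck_on (Suc (Suc 0)) UNIV F"
    using assms by (simp only: numeral_2_eq_2)
  then have dF: "F differentiable (at x)" and dD: "pd v F differentiable (at x)"
    and cDD: "continuous_on UNIV (pd w (pd v F))" and cD: "continuous_on UNIV (pd v F)" for x v w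
    using Ck_on_SucD[OF C] unfolding Ck_on_Suc_pd by (auto simp: Ck_on.simps(1))
  have eq: "pd a F (\<xi> + t *\<^sub>R b) - pd a F \<xi> = integral {0..t} (\<lambda>\<tau>. pd a (pd b F) (\<xi> + \<tau> *\<^sub>R b))"
    if t: "0 \<le> t" for t :: real
  proof -
    have ftc: "F (\<xi> + s *\<^sub>R a + t *\<^sub>R b) - F (\<xi> + s *\<^sub>R a)
        = integral (cbox 0 t) (\<lambda>\<tau>. pd b F (\<xi> + s *\<^sub>R a + \<tau> *\<^sub>R b))" for s
      using fundamental_theorem_of_calculus[OF t has_vector_derivative_line[OF dF, where v = b and x = "\<xi> + s *\<^sub>R a"]]
      by (simp add: integral_unique)
    \<comment> \<open>The increment of \<open>F\<close> in direction \<open>b\<close> is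
      differentiated in direction \<open>a\<close> at \<open>s = 0\<close> twice: directly, and
      under the integral of \<open>ftc\<close>. Uniqueness of the derivative equates the
      results.\<close>
    have "((\<lambda>s. F ((\<xi> + t *\<^sub>R b) + s *\<^sub>R a) - F (\<xi> + s *\<^sub>R a)) has_vector_derivative
        pd a F ((\<xi> + t *\<^sub>R b) + 0 *\<^sub>R a) - pd a F (\<xi> + 0 *\<^sub>R a)) (at 0)"
      by (intro has_vector_derivative_diff has_vector_derivative_line dF)
    moreover have "(\<lambda>s. F ((\<xi> + t *\<^sub>R b) + s *\<^sub>R a) - F (\<xi> + s *\<^sub>R a)) = (\<lambda>s. integral (cbox 0 t) (\<lambda>\<tau>. pd b F ((\<xi> + \<tau> *\<^sub>R b) + s *\<^sub>R a)))"
      using ftc by (simp add: fun_eq_iff ac_simps)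
    moreover have "((\<lambda>s. integral (cbox 0 t) (\<lambda>\<tau>. pd b F ((\<xi> + \<tau> *\<^sub>R b) + s *\<^sub>R a))) has_vector_derivative
        integral (cbox 0 t) (\<lambda>\<tau>. pd a (pd b F) ((\<xi> + \<tau> *\<^sub>R b) + 0 *\<^sub>R a))) (at 0 within UNIV)"
      by (intro leibniz_rule_vector_derivative has_vector_derivative_line dD integrable_continuous)
        (auto simp: split_beta intro!: continuous_on_compose2[OF cD _ subset_UNIV]
          continuous_on_compose2[OF cDD _ subset_UNIV] continuous_intros)
    ultimately show ?thesis
      using vector_derivative_unique_at[of "\<lambda>s. F ((\<xi> + t *\<^sub>R b) + s *\<^sub>R a) - F (\<xi> + s *\<^sub>R a)"] by simp
  qed
  have c: "continuous_on {0..1} (\<lambda>\<tau>. pd a (pd b F) (\<xi> + \<tau> *\<^sub>R b))"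
    by (auto intro!: continuous_on_compose2[OF cDD _ subset_UNIV] continuous_intros)
  \<comment> \<open>Since \<open>eq\<close> is available for \<open>t \<ge> 0\<close>, both
    derivatives at 0 are one-sided, taken within \<open>{0..1}\<close>, where they are still
    unique.\<close>
  have "((\<lambda>t. pd a F (\<xi> + t *\<^sub>R b) - pd a F \<xi>) has_vector_derivative pd a (pd b F) (\<xi> + 0 *\<^sub>R b))
      (at 0 within {0..1})"
    by (rule has_vector_derivative_transform[OF _ _ integral_has_vector_derivative[OF c]])
      (auto simp: eq)
  moreover have "((\<lambda>t. pd a F (\<xi> + t *\<^sub>R b) - pd a F \<xi>) has_vector_derivative
      pd b (pd a F) (\<xi> + 0 *\<^sub>R b) - 0) (at 0 within {0..1})"
    by (intro has_vector_derivative_diff has_vector_derivative_line dD has_vector_derivative_const)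
  ultimately have "pd a (pd b F) (\<xi> + 0 *\<^sub>R b) = pd b (pd a F) (\<xi> + 0 *\<^sub>R b) - 0"
    by (intro vector_derivative_unique_within) (auto simp: trivial_limit_within)
  then show ?thesis
    by simp
qed

text \<open>The Poincare lemma on the plane, with values in a Banach space. The normalization at the
  origin later fixes the additive constant of the surface.\<close>

lemma closed_form_has_primitive:
  fixes a b :: "complex \<Rightarrow> 'b::banach"
  assumes a: "Ck_on 1 UNIV a" and b: "Ck_on 1 UNIV b"
    and closed: "\<And>\<xi>. pd \<i> a \<xi> = pd 1 b \<xi>"
  obtains X where "X 0 = 0"
    "\<And>\<xi>. (X has_derivative (\<lambda>h. Re h *\<^sub>R a \<xi> + Im h *\<^sub>R b \<xi>)) (at \<xi>)"
proof -
  have da: "a differentiable (at x)" and db: "b differentiable (at x)" for x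
    using a b by simp_all
  have ca: "continuous_on UNIV a" and cb: "continuous_on UNIV b"
    and ca': "continuous_on UNIV (pd v a)" and cb': "continuous_on UNIV (pd v b)" for v
    using a b Ck_on_imp_continuous unfolding One_nat_def Ck_on_Suc_pd Ck_on.simps(1)
    by (blast intro: a b)+
  \<comment> \<open>\<open>X x\<close> integrates the form along the ray from the origin to \<open>x\<close>; closedness turns the derivative of
    the integrand in direction \<open>h\<close> into the \<open>t\<close>-derivative of \<open>t\<close> times the form at \<open>t x\<close>.\<close>
  define A where "A x t = a (t *\<^sub>R x) + t *\<^sub>R pd x a (t *\<^sub>R x)" for x and t :: real
  define B where "B x t = b (t *\<^sub>R x) + t *\<^sub>R pd x b (t *\<^sub>R x)" for x and t :: real
  define W where "W x h = Re h *\<^sub>R a x + Im h *\<^sub>R b x" for x h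
  \<comment> \<open>The derivative of the integrand is packaged as a \<open>blinfun\<close> because
    \<open>leibniz_rule\<close> integrates derivatives in the space of bounded linear maps.\<close>
  define \<Phi> where "\<Phi> x t = Blinfun (\<lambda>h. Re h *\<^sub>R A x t + Im h *\<^sub>R B x t)" for x and t :: real
  have \<Phi>: "blinfun_apply (\<Phi> x t) h = Re h *\<^sub>R A x t + Im h *\<^sub>R B x t" for x t h
    unfolding \<Phi>_def
    by (subst bounded_linear_Blinfun_apply) (auto intro!: bounded_linear_intros bounded_linear_Re bounded_linear_Im)
  note cont = continuous_on_compose2[OF ca _ subset_UNIV] continuous_on_compose2[OF cb _ subset_UNIV]
    continuous_on_compose2[OF ca' _ subset_UNIV] continuous_on_compose2[OF cb' _ subset_UNIV]
  have deriv: "((\<lambda>x. W (t *\<^sub>R x) x) has_derivative blinfun_apply (\<Phi> x t)) (at x)" for x and t :: real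
  proof -
    have s: "((\<lambda>x. t *\<^sub>R x) has_derivative (\<lambda>h. t *\<^sub>R h)) (at x)"
      by (auto intro!: derivative_eq_intros)
    note d = has_derivative_compose[OF s has_derivative_pd[OF da]]
      has_derivative_compose[OF s has_derivative_pd[OF db]]
    have "((\<lambda>x. W (t *\<^sub>R x) x) has_derivative (\<lambda>h. (Re x *\<^sub>R pd (t *\<^sub>R h) a (t *\<^sub>R x) + Re h *\<^sub>R a (t *\<^sub>R x))
        + (Im x *\<^sub>R pd (t *\<^sub>R h) b (t *\<^sub>R x) + Im h *\<^sub>R b (t *\<^sub>R x)))) (at x)"
      unfolding W_def
      by (intro has_derivative_add has_derivative_scaleR d has_derivative_Re has_derivative_Im has_derivative_ident)
    \<comment> \<open>Closedness enters here: after expansion in the directions 1 and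
      \<open>\<i>\<close>, it makes the derivative terms symmetric in \<open>x\<close> and
      \<open>h\<close>, so that both components are differentiated along \<open>x\<close> as in
      \<open>A\<close> and \<open>B\<close>.\<close>
    then show ?thesis
      by (rule has_derivative_eq_rhs)
        (simp add: fun_eq_iff \<Phi> A_def B_def pd_complex[OF da, of "_ *\<^sub>R _"] pd_complex[OF db, of "_ *\<^sub>R _"]
          pd_complex[OF da, of x] pd_complex[OF db, of x] closed algebra_simps)
  qed
  have cW: "continuous_on {0..1} (\<lambda>t. W (t *\<^sub>R x) x)" for x
    unfolding W_def by (intro cont continuous_intros)
  \<comment> \<open>The plane is finite-dimensional, so continuity in operator norm may be checked
    on the values at basis vectors.\<close>
  have c\<Phi>: "continuous_on (UNIV \<times> cbox 0 1) (\<lambda>(x, t). \<Phi> x t)"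
  proof (rule continuous_on_blinfun_componentwise)
    show "continuous_on (UNIV \<times> cbox 0 1) (\<lambda>p. blinfun_apply (case p of (x, t) \<Rightarrow> \<Phi> x t) i)" for i
      unfolding split_beta \<Phi> A_def B_def pd_complex[OF da, of "fst _"] pd_complex[OF db, of "fst _"]
      by (intro cont continuous_intros)
  qed
  define X where "X x = integral (cbox 0 1) (\<lambda>t. W (t *\<^sub>R x) x)" for x
  have "(X has_derivative (\<lambda>h. Re h *\<^sub>R a x + Im h *\<^sub>R b x)) (at x)" for x
  proof -
    have X: "(X has_derivative blinfun_apply (integral (cbox 0 1) (\<Phi> x))) (at x within UNIV)"
      unfolding X_def
      using cW by (intro leibniz_rule c\<Phi> deriv integrable_continuous) auto
    have "blinfun_apply (integral (cbox 0 1) (\<Phi> x)) h = W x h" for h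
    proof -
      have line: "((\<lambda>t. f (t *\<^sub>R x)) has_vector_derivative pd x f (t *\<^sub>R x)) (at t within {0..1})"
        if "\<And>x. f differentiable (at x)" for f :: "complex \<Rightarrow> 'b" and t
        using has_vector_derivative_line[OF that, where x = 0 and v = x] by simp
      have "((\<lambda>t. t *\<^sub>R W (t *\<^sub>R x) h) has_vector_derivative blinfun_apply (\<Phi> x t) h) (at t within {0..1})" for t
      proof -
        have "((\<lambda>t. W (t *\<^sub>R x) h) has_vector_derivative
            Re h *\<^sub>R pd x a (t *\<^sub>R x) + Im h *\<^sub>R pd x b (t *\<^sub>R x)) (at t within {0..1})"
          unfolding W_def
          by (intro has_vector_derivative_add line da db
              bounded_linear.has_vector_derivative[OF bounded_linear_scaleR_right])
        from has_vector_derivative_scaleR[OF DERIV_ident this] show ?thesis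
          by (simp add: W_def \<Phi> A_def B_def algebra_simps)
      qed
      from fundamental_theorem_of_calculus[OF _ this]
      have "((\<lambda>t. blinfun_apply (\<Phi> x t) h) has_integral W x h) {0..1}"
        by simp
      moreover have "continuous_on (cbox 0 1) (\<Phi> x)"
        by (rule continuous_on_compose2[OF c\<Phi>, of _ "\<lambda>t. (x, t)", simplified]) (auto intro!: continuous_intros)
      then have "\<Phi> x integrable_on cbox 0 1"
        by (rule integrable_continuous)
      ultimately show ?thesis
        by (simp add: blinfun_apply_integral integral_unique)
    qed
    then have "blinfun_apply (integral (cbox 0 1) (\<Phi> x)) = (\<lambda>h. Re h *\<^sub>R a x + Im h *\<^sub>R b x)"
      by (simp add: fun_eq_iff W_def)
    with X show ?thesis
      by simp
  qed
  moreover have "X 0 = 0"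
    by (simp add: X_def W_def)
  ultimately show ?thesis
    using that by blast
qed

lemma pd_bilinear:
  fixes f :: "complex \<Rightarrow> 'b::real_normed_vector" and g :: "complex \<Rightarrow> 'c::real_normed_vector"
  assumes "bounded_bilinear p" "f differentiable (at x)" "g differentiable (at x)"
  shows "pd v (\<lambda>x. p (f x) (g x)) x = p (f x) (pd v g x) + p (pd v f x) (g x)"
  by (rule pd_eqI[OF bounded_bilinear.FDERIV[OF assms(1) has_derivative_pd has_derivative_pd]]) fact+

lemma pd_linear:
  fixes f :: "complex \<Rightarrow> 'b::real_normed_vector"
  assumes "bounded_linear L" "f differentiable (at x)"
  shows "pd v (\<lambda>x. L (f x)) x = L (pd v f x)"
  by (rule pd_eqI[OF bounded_linear.has_derivative[OF assms(1) has_derivative_pd]]) fact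

section \<open>Rank-one projections\<close>

text \<open>In finite dimension bilinearity already gives boundedness. This and its companions below
  let the general rules for products and linear images act on matrix expressions.\<close>

lemma bounded_bilinear_matrix_mult:
  "bounded_bilinear (\<lambda>(A::complex^'n::finite^'m::finite) (B::complex^'k::finite^'n). A ** B)"
  by (rule bilinear_conv_bounded_bilinear[THEN iffD1])
    (auto simp: bilinear_def linear_iff matrix_matrix_mult_def vec_eq_iff algebra_simps
      sum.distrib scaleR_sum_right)

lemmas matrix_mult_linear_simps =
  bounded_bilinear.add_left[OF bounded_bilinear_matrix_mult]
  bounded_bilinear.add_right[OF bounded_bilinear_matrix_mult]
  bounded_bilinear.diff_left[OF bounded_bilinear_matrix_mult]
  bounded_bilinear.diff_right[OF bounded_bilinear_matrix_mult]
  bounded_bilinear.minus_left[OF bounded_bilinear_matrix_mult]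
  bounded_bilinear.minus_right[OF bounded_bilinear_matrix_mult]
  bounded_bilinear.zero_left[OF bounded_bilinear_matrix_mult]
  bounded_bilinear.zero_right[OF bounded_bilinear_matrix_mult]

lemma bounded_bilinear_scaleM:
  "bounded_bilinear (\<lambda>c (A::complex^'n::finite^'m::finite). c *\<^sub>M A)"
  by (rule bilinear_conv_bounded_bilinear[THEN iffD1])
    (auto simp: bilinear_def linear_iff scaleM_def vec_eq_iff algebra_simps)

lemma bounded_bilinear_col_row:
  "bounded_bilinear (\<lambda>(v::complex^'n::finite) r. col_row v r)"
  by (rule bilinear_conv_bounded_bilinear[THEN iffD1])
    (auto simp: bilinear_def linear_iff col_row_def vec_eq_iff algebra_simps)

lemma bounded_bilinear_row_col:
  "bounded_bilinear (\<lambda>(r::complex^'n::finite) v. row_col r v)"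
  by (rule bilinear_conv_bounded_bilinear[THEN iffD1])
    (auto simp: bilinear_def linear_iff row_col_def vec_eq_iff algebra_simps
      sum.distrib scaleR_sum_right)

lemma bounded_bilinear_commutator:
  "bounded_bilinear (\<lambda>(A::complex^'n::finite^'n) B. commutator A B)"
  by (rule bilinear_conv_bounded_bilinear[THEN iffD1])
    (auto simp: bilinear_def linear_iff commutator_def matrix_matrix_mult_def vec_eq_iff algebra_simps
      sum.distrib scaleR_sum_right)

lemma bounded_linear_herm: "bounded_linear (herm :: complex^'n::finite \<Rightarrow> _)"
  by (rule linear_conv_bounded_linear[THEN iffD1])
    (auto simp: linear_iff herm_def vec_eq_iff)

lemma bounded_linear_hermM: "bounded_linear (hermM :: complex^'n::finite^'m::finite \<Rightarrow> _)"
  by (rule linear_conv_bounded_linear[THEN iffD1])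
    (auto simp: linear_iff hermM_def vec_eq_iff)

lemma bounded_linear_trace: "bounded_linear (trace :: complex^'n::finite^'n \<Rightarrow> _)"
  by (rule linear_conv_bounded_linear[THEN iffD1])
    (auto simp: linear_iff trace_def sum.distrib scaleR_sum_right)

lemma row_col_herm_self: "row_col (herm v) v = of_real ((norm v)\<^sup>2)"
proof -
  have "(norm v)\<^sup>2 = (\<Sum>i\<in>UNIV. (norm (v $ i))\<^sup>2)"
    by (simp add: norm_vec_def L2_set_def sum_nonneg)
  moreover have "cnj x * x = of_real ((cmod x)\<^sup>2)" for x
    by (simp only: complex_norm_square mult.commute)
  ultimately show ?thesis
    by (simp add: row_col_def herm_def)
qed

lemma row_col_linear_simps:
  "row_col r (u + v) = row_col r u + row_col r v"
  "row_col r (u - v) = row_col r u - row_col r v"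
  "row_col r (c *s v) = c * row_col r v"
  "row_col (r + q) v = row_col r v + row_col q v"
  "row_col (r - q) v = row_col r v - row_col q v"
  "row_col (c *s r) v = c * row_col r v"
  by (simp_all add: row_col_def algebra_simps sum.distrib sum_subtractf sum_distrib_left)

lemma scaleM_mult: "(c *\<^sub>M A) ** B = c *\<^sub>M (A ** B)" "A ** (c *\<^sub>M B) = c *\<^sub>M (A ** B)"
  by (simp_all add: scaleM_def matrix_matrix_mult_def vec_eq_iff sum_distrib_left mult_ac)

lemma trace_scaleM: "trace (c *\<^sub>M A) = c * trace A"
  by (simp add: scaleM_def trace_def sum_distrib_left)

lemma trace_col_row: "trace (col_row v r) = row_col r v"
  by (simp add: trace_def col_row_def row_col_def mult.commute)

lemma col_row_mult: "col_row a b ** col_row c d = row_col b c *\<^sub>M col_row a d"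
  by (simp add: scaleM_def matrix_matrix_mult_def col_row_def row_col_def vec_eq_iff
      sum_distrib_left sum_distrib_right mult_ac)

lemma row_col_vector_matrix: "row_col (r v* A) v = row_col r (A *v v)"
  unfolding row_col_def vector_matrix_mult_def matrix_vector_mult_def
  by (simp add: sum_distrib_left sum_distrib_right mult_ac) (rule sum.swap)

lemma trace_commutator: "trace (commutator A B) = 0"
  by (simp add: commutator_def trace_sub trace_mul_sym[of A B])

text \<open>The pointwise form of \<open>projP\<close>, separating the algebra from the map
  \<open>f\<close>. For \<open>v \<noteq> 0\<close> it is the orthogonal projection onto the
  complement of the line through \<open>v\<close>.\<close>

definition proj :: "complex ^ 'n::finite \<Rightarrow> complex ^ 'n ^ 'n" where
  "proj v = mat 1 - (1 / row_col (herm v) v) *\<^sub>M col_row v (herm v)"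

lemma projP_eq_proj: "projP f \<xi> = proj (f \<xi>)"
  by (simp add: projP_def proj_def)

lemma proj_mult_vec: "proj v *v u = u - (row_col (herm v) u / row_col (herm v) v) *s v"
proof -
  have "(c *\<^sub>M col_row v r) *v u = (c * row_col r u) *s v" for c r
    by (simp add: scaleM_def col_row_def row_col_def matrix_vector_mult_def vec_eq_iff
        sum_distrib_left sum_distrib_right mult_ac)
  then show ?thesis
    by (simp add: proj_def matrix_vector_mult_diff_rdistrib)
qed

lemma vec_mult_proj: "r v* proj v = r - (row_col r v / row_col (herm v) v) *s herm v"
proof -
  have "r v* (c *\<^sub>M col_row v q) = (c * row_col r v) *s q" for c q
    by (simp add: scaleM_def col_row_def row_col_def vector_matrix_mult_def vec_eq_iff
        sum_distrib_left sum_distrib_right mult_ac)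
  moreover have "r v* (A - B) = r v* A - r v* B" for A B :: "complex ^ 'a ^ 'a"
    by (simp add: vector_matrix_mult_def vec_eq_iff algebra_simps sum_subtractf)
  ultimately show ?thesis
    by (simp add: proj_def)
qed

text \<open>The factors \<open>c\<close> and \<open>cnj c\<close> cancel against those in the
  squared norm, so the projection depends on the line alone. This permits a change of representative
  near infinity.\<close>

lemma proj_scale:
  assumes "c \<noteq> 0"
  shows "proj (c *s v) = proj v"
proof -
  have h: "herm (c *s v) = cnj c *s herm v"
    by (simp add: herm_def vec_eq_iff)
  show ?thesis
    using assms by (simp add: proj_def h row_col_linear_simps vec_eq_iff scaleM_def col_row_def)
qed

lemma hermM_proj: "hermM (proj v) = proj v"
  unfolding proj_def row_col_herm_self
  by (auto simp: hermM_def vec_eq_iff scaleM_def col_row_def herm_def mat_def)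

lemma proj_annihilates:
  assumes "v \<noteq> 0"
  shows "proj v *v v = 0" "herm v v* proj v = 0"
  using assms by (simp_all add: proj_mult_vec vec_mult_proj row_col_herm_self)

text \<open>Expanding only the second factor suffices: its rank-one part has column
  \<open>v\<close>, which the first factor kills.\<close>

lemma proj_idempotent:
  assumes "v \<noteq> 0"
  shows "proj v ** proj v = proj v"
proof -
  have gen: "proj v ** (c *\<^sub>M col_row v r) = c *\<^sub>M col_row (proj v *v v) r" for c r
    by (simp add: scaleM_def matrix_matrix_mult_def col_row_def matrix_vector_mult_def vec_eq_iff
      sum_distrib_left sum_distrib_right mult_ac)
  have 0: "proj v ** ((1 / row_col (herm v) v) *\<^sub>M col_row v (herm v)) = 0"
    unfolding gen proj_annihilates[OF assms] by (simp add: col_row_def scaleM_def vec_eq_iff)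
  have "proj v ** proj v = proj v ** mat 1 - proj v ** ((1 / row_col (herm v) v) *\<^sub>M col_row v (herm v))"
    by (subst (2) proj_def) (rule matrix_mult_linear_simps)
  then show ?thesis
    by (simp add: 0)
qed

text \<open>The Wirtinger derivatives of \<open>proj f\<close> have this shape, with \<open>u\<close> and \<open>r\<close> the corresponding
  derivatives of \<open>f\<close> and of its Hermitian conjugate.\<close>

lemma trace_square_proj_deriv:
  assumes v: "v \<noteq> 0"
    and A: "A = (- 1 / row_col (herm v) v) *\<^sub>M
      (col_row (proj v *v u) (herm v) + col_row v (r v* proj v))"
  shows "trace (A ** A) = 2 * (1 / row_col (herm v) v * row_col r (proj v *v u))"
proof -
  define s where "s = row_col (herm v) v"
  have s: "s \<noteq> 0"
    using v by (simp add: s_def row_col_herm_self)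
  \<comment> \<open>The square of \<open>A\<close> has four rank-one terms. These contractions kill
    two of them, and each of the others has trace \<open>s * row_col r (proj v *v u)\<close> before
    the prefactor \<open>1 / s\<^sup>2\<close>.\<close>
  have "row_col (herm v) (proj v *v u) = 0" "row_col (r v* proj v) v = 0"
    "row_col (r v* proj v) (proj v *v u) = row_col r (proj v *v u)"
    using proj_annihilates[OF v] proj_idempotent[OF v]
    by (simp_all add: row_col_vector_matrix matrix_vector_mul_assoc flip: row_col_vector_matrix[of "herm v"])
       (simp_all add: row_col_def)
  then show ?thesis
    using s unfolding A s_def[symmetric]
    by (simp add: scaleM_mult trace_scaleM matrix_mult_linear_simps col_row_mult
      trace_add trace_col_row s_def[symmetric])
qed

text \<open>By the product rule; differentiating the reciprocal of the squared norm supplies exactly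
  the terms that project the derivatives of \<open>f\<close> and of its conjugate off the
  line.\<close>

lemma has_derivative_projP:
  fixes f :: "complex \<Rightarrow> complex ^ 'n::finite"
  assumes f: "f differentiable (at \<xi>)" and nz: "f \<xi> \<noteq> 0"
  shows "(projP f has_derivative (\<lambda>\<mu>. (- 1 / row_col (herm (f \<xi>)) (f \<xi>)) *\<^sub>M
    (col_row (proj (f \<xi>) *v pd \<mu> f \<xi>) (herm (f \<xi>)) +
     col_row (f \<xi>) (herm (pd \<mu> f \<xi>) v* proj (f \<xi>))))) (at \<xi>)"
proof -
  define s where "s = row_col (herm (f \<xi>)) (f \<xi>)"
  have s: "s \<noteq> 0"
    using nz by (simp add: s_def row_col_herm_self)
  \<comment> \<open>The entrywise identity: \<open>a\<close>, \<open>d\<close> are entries of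
    \<open>f\<close> and its conjugate, \<open>c\<close>, \<open>b\<close> those of their
    derivatives, and \<open>p + q\<close> is the derivative of \<open>s\<close>.\<close>
  have alg: "0 - (inverse s * (a * b + c * d) + - (inverse s * (p + q) * inverse s) * (a * d)) =
      (- 1 / s) * ((c - p / s * a) * d + a * (b - q / s * d))" for s a b c d p q :: complex
    by (simp add: divide_inverse algebra_simps)
  note d = has_derivative_pd[OF f]
  note dh = bounded_linear.has_derivative[OF bounded_linear_herm d]
  note ds = bounded_bilinear.FDERIV[OF bounded_bilinear_row_col dh d]
  note di = Deriv.has_derivative_inverse[OF s[unfolded s_def] ds]
  note dP = has_derivative_diff[OF has_derivative_const bounded_bilinear.FDERIV[OF bounded_bilinear_scaleM di
        bounded_bilinear.FDERIV[OF bounded_bilinear_col_row d dh]]]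
  have P: "projP f = (\<lambda>\<zeta>. mat 1 - inverse (row_col (herm (f \<zeta>)) (f \<zeta>)) *\<^sub>M col_row (f \<zeta>) (herm (f \<zeta>)))"
    by (simp add: projP_def fun_eq_iff divide_inverse)
  show ?thesis
    unfolding P
    by (rule has_derivative_eq_rhs[OF dP], rule ext)
      (simp only: s_def[symmetric] proj_mult_vec vec_mult_proj vec_eq_iff scaleM_def col_row_def vec_lambda_beta
        vector_minus_component vector_add_component vector_scalar_mult_def zero_index alg simp_thms)
qed

lemma pd_herm: "f differentiable (at \<xi>) \<Longrightarrow> pd \<mu> (\<lambda>\<zeta>. herm (f \<zeta>)) \<xi> = herm (pd \<mu> f \<xi>)"
  by (rule pd_linear[OF bounded_linear_herm])

text \<open>Taking \<open>c = - \<i>\<close> or \<open>c = \<i>\<close> treats both Wirtinger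
  derivatives at once. The row carries the same \<open>c\<close>, unconjugated: it is the derivative
  of the conjugate of \<open>f\<close>, as in \<open>J\<close> and \<open>Jbar\<close>.\<close>

lemma wirtinger_projP:
  fixes f :: "complex \<Rightarrow> complex ^ 'n::finite"
  assumes f: "f differentiable (at \<xi>)" and nz: "f \<xi> \<noteq> 0"
  shows "(1 / 2) *\<^sub>M (pd 1 (projP f) \<xi> + c *\<^sub>M pd \<i> (projP f) \<xi>) =
    (- 1 / row_col (herm (f \<xi>)) (f \<xi>)) *\<^sub>M
    (col_row (proj (f \<xi>) *v ((1 / 2) *s (pd 1 f \<xi> + c *s pd \<i> f \<xi>))) (herm (f \<xi>)) +
     col_row (f \<xi>) (((1 / 2) *s (herm (pd 1 f \<xi>) + c *s herm (pd \<i> f \<xi>))) v* proj (f \<xi>)))"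
  unfolding pd_eqI[OF has_derivative_projP[OF assms]] proj_mult_vec vec_mult_proj row_col_linear_simps
  by (simp add: vec_eq_iff scaleM_def col_row_def add_divide_distrib algebra_simps)

text \<open>Expresses \<open>J\<close> through the projection alone, hence independently of the
  representative \<open>f\<close>. This is what makes a comparison of the two charts of the sphere
  possible.\<close>

lemma trace_dM_projP:
  fixes f :: "complex \<Rightarrow> complex ^ 'n::finite"
  assumes f: "f differentiable (at \<xi>)" and nz: "f \<xi> \<noteq> 0"
  shows "trace (dM (projP f) \<xi> ** dM (projP f) \<xi>) = 2 * J f \<xi>"
proof -
  have minus: "A - \<i> *\<^sub>M B = A + (- \<i>) *\<^sub>M B" "u - \<i> *s v = u + (- \<i>) *s v"
    for A B :: "complex^'n^'n" and u v :: "complex^'n"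
    by (simp_all add: scaleM_def vec_eq_iff)
  show ?thesis
    unfolding J_def projP_eq_proj[of f \<xi>] dM_def dV_def pd_herm[OF f] minus
    by (rule trace_square_proj_deriv[OF nz wirtinger_projP[OF f nz]])
qed

lemma trace_dbarM_projP:
  assumes f: "f differentiable (at \<xi>)" and nz: "f \<xi> \<noteq> 0"
  shows "trace (dbarM (projP f) \<xi> ** dbarM (projP f) \<xi>) = 2 * Jbar f \<xi>"
  unfolding Jbar_def projP_eq_proj[of f \<xi>] dbarM_def dbarV_def pd_herm[OF f]
  by (rule trace_square_proj_deriv[OF nz wirtinger_projP[OF f nz]])

section \<open>The sigma model equation\<close>

lemma scaleM_linear_simps:
  "c *\<^sub>M (A + B) = c *\<^sub>M A + c *\<^sub>M B" "c *\<^sub>M (A - B) = c *\<^sub>M A - c *\<^sub>M B"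
  "c *\<^sub>M (- A) = - (c *\<^sub>M A)" "c *\<^sub>M d *\<^sub>M A = (c * d) *\<^sub>M A"
  by (simp_all add: scaleM_def vec_eq_iff algebra_simps)

lemma commutator_linear_simps:
  "commutator (A + B) C = commutator A C + commutator B C"
  "commutator (A - B) C = commutator A C - commutator B C"
  "commutator (c *\<^sub>M A) C = c *\<^sub>M commutator A C"
  by (simp_all add: commutator_def matrix_mult_linear_simps scaleM_mult scaleM_linear_simps)

lemma dM_eq: "dM G \<xi> = (1 / 2) *\<^sub>M (pd 1 G \<xi> + (- \<i>) *\<^sub>M pd \<i> G \<xi>)"
  by (simp add: dM_def scaleM_def vec_eq_iff)

lemma has_derivative_wirtinger_combination:
  fixes G H :: "complex \<Rightarrow> complex ^ 'n::finite ^ 'm::finite"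
  assumes "G differentiable (at \<xi>)" "H differentiable (at \<xi>)"
  shows "((\<lambda>\<zeta>. (1 / 2) *\<^sub>M (G \<zeta> + c *\<^sub>M H \<zeta>)) has_derivative
    (\<lambda>v. (1 / 2) *\<^sub>M (pd v G \<xi> + c *\<^sub>M pd v H \<xi>))) (at \<xi>)"
  by (intro bounded_linear.has_derivative[OF bounded_bilinear.bounded_linear_right[OF bounded_bilinear_scaleM]]
      has_derivative_add has_derivative_pd assms)

lemma pd_wirtinger:
  fixes G :: "complex \<Rightarrow> complex ^ 'n::finite ^ 'm::finite"
  assumes "G differentiable (at \<xi>)"
  shows "pd h G \<xi> = h *\<^sub>M dM G \<xi> + cnj h *\<^sub>M dbarM G \<xi>"
proof -
  define x y where "x = Re h" and "y = Im h"
  have h: "h = of_real x + \<i> * of_real y" "cnj h = of_real x - \<i> * of_real y"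
    by (simp_all add: x_def y_def complex_eq_iff)
  have r: "r *\<^sub>R A = of_real r *\<^sub>M A" for r and A :: "complex ^ 'n ^ 'm"
    by (simp add: vec_eq_iff scaleM_def scaleR_conv_of_real[where 'a = complex])
  have "pd h G \<xi> = of_real x *\<^sub>M pd 1 G \<xi> + of_real y *\<^sub>M pd \<i> G \<xi>"
    unfolding pd_complex[OF assms, of h] x_def y_def r ..
  then show ?thesis
    unfolding h dM_def dbarM_def
    by (simp add: vec_eq_iff scaleM_def field_simps)
qed

lemma Ck_on_projP:
  fixes f :: "complex \<Rightarrow> complex ^ 'n::finite"
  assumes f: "Ck_on k UNIV f" and nz: "\<And>\<xi>. f \<xi> \<noteq> 0"
  shows "Ck_on k UNIV (projP f)"
proof -
  have P: "projP f = (\<lambda>\<zeta>. mat 1 - inverse (row_col (herm (f \<zeta>)) (f \<zeta>)) *\<^sub>M col_row (f \<zeta>) (herm (f \<zeta>)))"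
    by (simp add: projP_def fun_eq_iff divide_inverse)
  show ?thesis
    unfolding P
    by (intro Ck_on_diff Ck_on_const Ck_on_bilinear[OF bounded_bilinear_scaleM] Ck_on_inverse
        Ck_on_bilinear[OF bounded_bilinear_row_col] Ck_on_bilinear[OF bounded_bilinear_col_row]
        Ck_on_linear[OF bounded_linear_herm] f) (simp add: row_col_herm_self nz)
qed

lemma trace_minus: "trace (- A) = - trace (A :: complex ^ 'n::finite ^ 'n)"
  by (simp add: trace_def sum_negf)

text \<open>Multiplying the hypothesis on \<open>A\<close> by \<open>P\<close> from the left gives
  \<open>P ** A ** P = 0\<close>, so \<open>A\<close> is off-diagonal for the splitting by
  \<open>P\<close>, while \<open>L\<close> is block-diagonal. Cyclicity of the trace does the
  rest.\<close>

lemma trace_off_diagonal_mult: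
  assumes PP: "P ** P = P" and A: "A ** P + P ** A = A" and L: "L ** P = P ** L"
  shows "trace (A ** L) = (0::complex)"
proof -
  have "P ** A ** P + P ** A = P ** (A ** P + P ** A)"
    by (simp add: matrix_mult_linear_simps matrix_mul_assoc PP)
  then have 0: "P ** A ** P = 0"
    by (simp add: A)
  have "trace (A ** P ** L) = trace (A ** P ** (P ** L))"
    by (metis PP matrix_mul_assoc)
  also have "\<dots> = trace (P ** (A ** P ** L))"
    by (metis L matrix_mul_assoc trace_mul_sym)
  also have "\<dots> = 0"
    by (simp add: matrix_mul_assoc 0 matrix_mult_linear_simps trace_def)
  finally have 1: "trace (A ** P ** L) = 0" .
  have "trace (A ** L) = trace ((A ** P + P ** A) ** L)"
    by (simp only: A)
  also have "\<dots> = trace (A ** P ** L) + trace (P ** (A ** L))"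
    by (simp add: matrix_mult_linear_simps matrix_mul_assoc trace_add)
  also have "trace (P ** (A ** L)) = trace (A ** P ** L)"
    by (metis L matrix_mul_assoc trace_mul_sym)
  finally show ?thesis
    by (simp add: 1)
qed

text \<open>Of the four products in the square, two contain \<open>P ** A ** P = 0\<close>. The
  traces of the other two recombine, by cyclicity, to that of
  \<open>A ** (A ** P + P ** A)\<close>.\<close>

lemma trace_square_commutator:
  fixes A P :: "complex ^ 'n::finite ^ 'n"
  assumes PP: "P ** P = P" and A: "A ** P + P ** A = A"
  shows "trace (commutator A P ** commutator A P) = - trace (A ** A)"
proof -
  have "P ** A ** P + P ** A = P ** (A ** P + P ** A)"
    by (simp add: matrix_mult_linear_simps matrix_mul_assoc PP)
  then have 0: "P ** A ** P = 0"
    by (simp add: A)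
  have "A ** P ** (A ** P) = A ** (P ** A ** P)" "P ** A ** (P ** A) = P ** A ** P ** A"
    by (simp_all only: matrix_mul_assoc)
  with 0 have 1: "A ** P ** (A ** P) = 0" "P ** A ** (P ** A) = 0"
    by (simp_all add: matrix_mult_linear_simps)
  have "trace (commutator A P ** commutator A P) = - (trace (A ** P ** (P ** A)) + trace (P ** A ** (A ** P)))"
    by (simp add: commutator_def matrix_mult_linear_simps 1 trace_add trace_sub trace_minus)
  also have "trace (A ** P ** (P ** A)) = trace (A ** (A ** P))"
    by (metis PP matrix_mul_assoc trace_mul_sym)
  also have "trace (P ** A ** (A ** P)) = trace (A ** (P ** A))"
    by (metis PP matrix_mul_assoc trace_mul_sym)
  also have "trace (A ** (A ** P)) + trace (A ** (P ** A)) = trace (A ** (A ** P + P ** A))"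
    by (simp add: matrix_mult_linear_simps trace_add)
  finally show ?thesis
    by (simp add: A)
qed

text \<open>Differentiating the idempotency of \<open>P\<close> shows that its derivatives are
  off-diagonal, the form required by the trace lemmas above.\<close>

lemma pd_projection:
  fixes P :: "complex \<Rightarrow> complex ^ 'n::finite ^ 'n"
  assumes d: "P differentiable (at \<xi>)" and PP: "\<And>\<zeta>. P \<zeta> ** P \<zeta> = P \<zeta>"
  shows "pd v P \<xi> ** P \<xi> + P \<xi> ** pd v P \<xi> = pd v P \<xi>"
  using pd_bilinear[OF bounded_bilinear_matrix_mult d d, of v]
  unfolding PP by (subst add.commute) (rule sym)

lemma dM_projection:
  fixes P :: "complex \<Rightarrow> complex ^ 'n::finite ^ 'n"
  assumes "P differentiable (at \<xi>)" and "\<And>\<zeta>. P \<zeta> ** P \<zeta> = P \<zeta>"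
  shows "dM P \<xi> ** P \<xi> + P \<xi> ** dM P \<xi> = dM P \<xi>"
    and "dbarM P \<xi> ** P \<xi> + P \<xi> ** dbarM P \<xi> = dbarM P \<xi>"
proof -
  have "((1 / 2) *\<^sub>M (A + c *\<^sub>M B)) ** Q + Q ** ((1 / 2) *\<^sub>M (A + c *\<^sub>M B)) =
     (1 / 2) *\<^sub>M ((A ** Q + Q ** A) + c *\<^sub>M (B ** Q + Q ** B))" for c and A B Q :: "complex ^ 'n ^ 'n"
    by (simp add: scaleM_mult matrix_mult_linear_simps scaleM_linear_simps algebra_simps)
  then show "dM P \<xi> ** P \<xi> + P \<xi> ** dM P \<xi> = dM P \<xi>"
    and "dbarM P \<xi> ** P \<xi> + P \<xi> ** dbarM P \<xi> = dbarM P \<xi>"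
    by (simp_all only: dM_eq dbarM_def pd_projection[OF assms])
qed

lemma projP_idempotent: "f \<xi> \<noteq> 0 \<Longrightarrow> projP f \<xi> ** projP f \<xi> = projP f \<xi>"
  by (simp add: projP_eq_proj proj_idempotent)

section \<open>The equation for the projection of a nowhere vanishing map of class C^2\<close>

context
  fixes f :: "complex \<Rightarrow> complex ^ 'n::finite"
  assumes f: "Ck_on 2 UNIV f" and nz: "\<And>\<xi>. f \<xi> \<noteq> 0"
begin

lemma Ck_2_projP: "Ck_on 2 UNIV (projP f)"
  by (rule Ck_on_projP[OF f nz])

lemma Ck_on_pd_projP: "Ck_on 1 UNIV (pd v (projP f))"
  using Ck_2_projP unfolding numeral_2_eq_2 One_nat_def Ck_on_Suc_pd by blast

lemma projP_differentiable: "projP f differentiable (at \<xi>)"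
  using Ck_2_projP by (simp add: numeral_2_eq_2)

lemma pd_projP_differentiable: "pd v (projP f) differentiable (at \<xi>)"
  using Ck_on_pd_projP by simp

lemma Ck_on_pd_projP_commutator: "Ck_on 1 UNIV (\<lambda>\<zeta>. commutator (pd v (projP f) \<zeta>) (projP f \<zeta>))"
  using Ck_on_le[OF Ck_2_projP, of 1] by (intro Ck_on_bilinear[OF bounded_bilinear_commutator] Ck_on_pd_projP) simp

text \<open>The terms with a factor \<open>\<i>\<close> cancel between the two summands of the
  equation, leaving half of this divergence. It yields both the commuting Laplacian and the
  closedness of the Weierstrass form.\<close>

lemma sigma_model_divergence:
  assumes sol: "sigma_model_eq f"
  shows "pd 1 (\<lambda>\<zeta>. commutator (pd 1 (projP f) \<zeta>) (projP f \<zeta>)) \<xi> +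
   pd \<i> (\<lambda>\<zeta>. commutator (pd \<i> (projP f) \<zeta>) (projP f \<zeta>)) \<xi> = 0"
proof -
  define C where "C v \<zeta> = commutator (pd v (projP f) \<zeta>) (projP f \<zeta>)" for v \<zeta>
  have dC: "C v differentiable (at \<zeta>)" for v \<zeta>
    using Ck_on_pd_projP_commutator[of v] unfolding C_def[abs_def] by simp
  have "(\<lambda>\<zeta>. commutator (dbarM (projP f) \<zeta>) (projP f \<zeta>)) = (\<lambda>\<zeta>. (1 / 2) *\<^sub>M (C 1 \<zeta> + \<i> *\<^sub>M C \<i> \<zeta>))"
    "(\<lambda>\<zeta>. commutator (dM (projP f) \<zeta>) (projP f \<zeta>)) = (\<lambda>\<zeta>. (1 / 2) *\<^sub>M (C 1 \<zeta> + (- \<i>) *\<^sub>M C \<i> \<zeta>))"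
    by (simp_all add: fun_eq_iff C_def dM_eq dbarM_def commutator_linear_simps)
  with sol have "dM (\<lambda>\<zeta>. (1 / 2) *\<^sub>M (C 1 \<zeta> + \<i> *\<^sub>M C \<i> \<zeta>)) \<xi> +
    dbarM (\<lambda>\<zeta>. (1 / 2) *\<^sub>M (C 1 \<zeta> + (- \<i>) *\<^sub>M C \<i> \<zeta>)) \<xi> = 0"
    by (simp add: sigma_model_eq_def)
  moreover have "dM (\<lambda>\<zeta>. (1 / 2) *\<^sub>M (C 1 \<zeta> + \<i> *\<^sub>M C \<i> \<zeta>)) \<xi> +
    dbarM (\<lambda>\<zeta>. (1 / 2) *\<^sub>M (C 1 \<zeta> + (- \<i>) *\<^sub>M C \<i> \<zeta>)) \<xi> = (1 / 2) *\<^sub>M (pd 1 (C 1) \<xi> + pd \<i> (C \<i>) \<xi>)"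
    unfolding dM_def dbarM_def pd_eqI[OF has_derivative_wirtinger_combination[OF dC dC]]
    by (simp add: vec_eq_iff scaleM_def field_simps)
  ultimately have "pd 1 (C 1) \<xi> + pd \<i> (C \<i>) \<xi> = 0"
    by (simp add: vec_eq_iff scaleM_def)
  then show ?thesis
    by (simp add: C_def[abs_def])
qed

text \<open>The product rule on the divergence also produces commutators of a first derivative with
  itself, which vanish.\<close>

lemma laplacian_commutes:
  assumes sol: "sigma_model_eq f"
  shows "(pd 1 (pd 1 (projP f)) \<xi> + pd \<i> (pd \<i> (projP f)) \<xi>) ** projP f \<xi> =
   projP f \<xi> ** (pd 1 (pd 1 (projP f)) \<xi> + pd \<i> (pd \<i> (projP f)) \<xi>)"
  using sigma_model_divergence[OF sol, of \<xi>]
  unfolding pd_bilinear[OF bounded_bilinear_commutator pd_projP_differentiable projP_differentiable]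
  by (simp add: commutator_def matrix_mult_linear_simps algebra_simps)

lemma holomorphic_trace:
  assumes sol: "sigma_model_eq f"
  shows "(\<lambda>\<xi>. trace (dM (projP f) \<xi> ** dM (projP f) \<xi>)) holomorphic_on UNIV"
proof -
  let ?P = "projP f"
  define T where "T \<xi> = trace (dM ?P \<xi> ** dM ?P \<xi>)" for \<xi>
  define D where "D v \<xi> = (1 / 2) *\<^sub>M (pd v (pd 1 ?P) \<xi> + (- \<i>) *\<^sub>M pd v (pd \<i> ?P) \<xi>)" for v \<xi>
  have "(dM ?P has_derivative (\<lambda>v. D v \<xi>)) (at \<xi>)" for \<xi>
    unfolding dM_eq[abs_def] D_def
    by (rule has_derivative_wirtinger_combination[OF pd_projP_differentiable pd_projP_differentiable])
  note dT = bounded_linear.has_derivative[OF bounded_linear_trace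
      bounded_bilinear.FDERIV[OF bounded_bilinear_matrix_mult this this], folded T_def]
  have pdT: "pd v T \<xi> = 2 * trace (dM ?P \<xi> ** D v \<xi>)" for v \<xi>
    unfolding pd_eqI[OF dT] by (simp add: trace_add trace_mul_sym[of "D v \<xi>"])
  \<comment> \<open>By Schwarz's theorem the mixed derivatives cancel; the left side is twice the
    \<open>dbarM\<close> derivative of \<open>dM ?P\<close>, hence a multiple of the
    Laplacian.\<close>
  have "D 1 \<xi> + \<i> *\<^sub>M D \<i> \<xi> = (1 / 2) *\<^sub>M (pd 1 (pd 1 ?P) \<xi> + pd \<i> (pd \<i> ?P) \<xi>)" for \<xi>
    unfolding D_def pd_commute[OF Ck_2_projP, of \<i> 1] by (simp add: vec_eq_iff scaleM_def algebra_simps)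
  then have "trace (dM ?P \<xi> ** (D 1 \<xi> + \<i> *\<^sub>M D \<i> \<xi>)) = 0" for \<xi>
    using trace_off_diagonal_mult[OF projP_idempotent[OF nz]
      dM_projection(1)[OF projP_differentiable projP_idempotent[OF nz]] laplacian_commutes[OF sol]]
    by (simp add: scaleM_mult trace_scaleM)
  moreover have "pd 1 T \<xi> + \<i> * pd \<i> T \<xi> = 2 * trace (dM ?P \<xi> ** (D 1 \<xi> + \<i> *\<^sub>M D \<i> \<xi>))" for \<xi>
    by (simp add: pdT matrix_mult_linear_simps scaleM_mult trace_add trace_scaleM algebra_simps)
  ultimately have "pd 1 T \<xi> + \<i> * pd \<i> T \<xi> = 0" for \<xi>
    by simp
  \<comment> \<open>The factor \<open>\<i>\<close> brings the equation into Cauchy-Riemann form; the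
    real derivative of \<open>T\<close> is then multiplication by \<open>pd 1 T \<xi>\<close>, hence
    complex-linear.\<close>
  then have "\<i> * (pd 1 T \<xi> + \<i> * pd \<i> T \<xi>) = 0" for \<xi>
    by simp
  then have CR: "pd \<i> T \<xi> = \<i> * pd 1 T \<xi>" for \<xi>
    by (simp add: algebra_simps)
  have dT': "T differentiable (at \<xi>)" for \<xi>
    by (rule differentiableI[OF dT])
  have "(\<lambda>v. pd v T \<xi>) = (\<lambda>v. pd 1 T \<xi> * v)" for \<xi>
  proof
    show "pd v T \<xi> = pd 1 T \<xi> * v" for v
      unfolding pd_complex[OF dT', of v] CR by (simp add: complex_eq_iff)
  qed
  with has_derivative_pd[OF dT'] have "(T has_field_derivative pd 1 T \<xi>) (at \<xi>)" for \<xi>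
    by (simp only: has_field_derivative_def)
  then show ?thesis
    unfolding T_def[abs_def, symmetric] by (auto simp: holomorphic_on_open)
qed

end

section \<open>Behaviour at infinity\<close>

text \<open>Justifies the definite description in \<open>affine_chart\<close>: a generator
  \<open>u\<close> of the line has \<open>u $ j \<noteq> 0\<close>, and rescaling it by the inverse
  of that entry is the only way to reach entry 1.\<close>

lemma affine_chart_mem:
  assumes "L \<in> chart_dom j"
  shows "affine_chart j L \<in> L" "affine_chart j L $ j = 1"
proof -
  obtain u where L: "L = range (\<lambda>k. k *s u)"
    using assms by (auto simp: chart_dom_def CP_def cline_def vec.span_singleton)
  have j: "u $ j \<noteq> 0"
    using assms by (auto simp: chart_dom_def L)
  have "affine_chart j L \<in> L \<and> affine_chart j L $ j = 1"
    unfolding affine_chart_def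
  proof (rule theI)
    show "inverse (u $ j) *s u \<in> L \<and> (inverse (u $ j) *s u) $ j = 1"
      using j by (auto simp: L)
    show "v = inverse (u $ j) *s u" if "v \<in> L \<and> v $ j = 1" for v
      using that j by (auto simp: L field_simps)
  qed
  then show "affine_chart j L \<in> L" "affine_chart j L $ j = 1"
    by auto
qed

text \<open>The representative \<open>v\<close> comes from the affine chart around the image of
  infinity. Away from \<open>w = 0\<close> it is a nonzero multiple of \<open>f (1 / w)\<close>, so
  the projections agree. Order 1 is what \<open>J v\<close> involves.\<close>

lemma projP_smooth_at_infinity:
  fixes F :: "complex option \<Rightarrow> (complex ^ 'n::finite) set"
  assumes F: "smooth_map_S2_CP F" and rep: "\<And>\<xi>. F (Some \<xi>) = cline (f \<xi>)"
  obtains v V where "open V" "0 \<in> V" "Ck_on 1 V v" "\<forall>w\<in>V. v w \<noteq> 0"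
    "\<forall>w\<in>V - {0}. projP v w = projP f (1 / w)"
proof -
  define G where "G w = F (if w = 0 then None else Some (1 / w))" for w
  from F have "smooth_map_CP G"
    by (simp add: smooth_map_S2_CP_def G_def[abs_def])
  then have "\<exists>j V. open V \<and> 0 \<in> V \<and> (\<forall>w\<in>V. G w \<in> chart_dom j) \<and> smooth_on V (\<lambda>w. affine_chart j (G w))"
    unfolding smooth_map_CP_def by (rule spec)
  then obtain j V where V: "open V" "0 \<in> V" and G: "\<forall>w\<in>V. G w \<in> chart_dom j"
    and s: "smooth_on V (\<lambda>w. affine_chart j (G w))"
    by (elim exE conjE)
  define v where "v w = affine_chart j (G w)" for w
  note v = affine_chart_mem[OF bspec[OF G], folded v_def]
  have nz: "v w \<noteq> 0" if "w \<in> V" for w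
    using v(2)[OF that] by auto
  show ?thesis
  proof (rule that[OF V])
    show "Ck_on 1 V v"
      using s by (simp only: smooth_on_def v_def[abs_def])
    show "\<forall>w\<in>V. v w \<noteq> 0"
      using nz by blast
    have "projP v w = projP f (1 / w)" if w: "w \<in> V" "w \<noteq> 0" for w
    proof -
      have "v w \<in> range (\<lambda>k. k *s f (1 / w))"
        using v(1)[OF w(1)] w(2) by (simp add: G_def rep cline_def vec.span_singleton)
      then obtain k where k: "v w = k *s f (1 / w)"
        by blast
      with nz[OF w(1)] have "k \<noteq> 0"
        by auto
      then show ?thesis
        by (simp add: projP_eq_proj k proj_scale)
    qed
    then show "\<forall>w\<in>V - {0}. projP v w = projP f (1 / w)"
      by blast
  qed
qed

text \<open>The inner map is holomorphic, so \<open>dbarM G\<close> does not contribute and the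
  chain rule leaves the complex derivative of \<open>1 / w\<close> as a factor.\<close>

lemma dM_compose_inverse:
  fixes G :: "complex \<Rightarrow> complex ^ 'n::finite ^ 'm::finite"
  assumes w: "w \<noteq> 0" and G: "G differentiable (at (1 / w))"
  shows "dM (\<lambda>w. G (1 / w)) w = (- 1 / w\<^sup>2) *\<^sub>M dM G (1 / w)"
proof -
  have "((\<lambda>w. 1 / w) has_field_derivative - 1 / w\<^sup>2) (at w)"
    using w by (auto intro!: derivative_eq_intros simp: power2_eq_square field_simps)
  then have "((\<lambda>w. 1 / w) has_derivative (\<lambda>h. (- 1 / w\<^sup>2) * h)) (at w)"
    by (simp only: has_field_derivative_def)
  note d = has_derivative_compose[OF this has_derivative_pd[OF G]]
  show ?thesis
    unfolding dM_def[of "\<lambda>w. G (1 / w)"] pd_eqI[OF d] pd_wirtinger[OF G]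
    by (simp add: vec_eq_iff scaleM_def field_simps)
qed

lemma bounded_bilinear_vector_scalar:
  "bounded_bilinear (\<lambda>c (v::complex^'n::finite). c *s v)"
  by (rule bilinear_conv_bounded_bilinear[THEN iffD1])
    (auto simp: bilinear_def linear_iff vec_eq_iff algebra_simps)

text \<open>\<open>J v\<close> is built from \<open>v\<close> and its first derivatives with
  nonvanishing denominators. At \<open>w = 0\<close> this supplies the finite limit that controls
  the trace at infinity.\<close>

lemma continuous_on_J:
  fixes v :: "complex \<Rightarrow> complex ^ 'n::finite"
  assumes C: "Ck_on 1 V v" and nz: "\<And>w. w \<in> V \<Longrightarrow> v w \<noteq> 0"
  shows "continuous_on V (J v)"
proof -
  have cv: "continuous_on V v" and dv: "\<And>w. w \<in> V \<Longrightarrow> v differentiable (at w)"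
    and cpd: "\<And>u. continuous_on V (pd u v)"
    using C Ck_on_imp_continuous[OF C] by (simp_all add: pd_def[abs_def])
  note c = bounded_bilinear.continuous_on[OF bounded_bilinear_row_col]
    bounded_bilinear.continuous_on[OF bounded_bilinear_vector_scalar]
    bounded_linear.continuous_on[OF bounded_linear_herm]
  have "continuous_on V (\<lambda>w. 1 / row_col (herm (v w)) (v w) *
    row_col ((1 / 2) *s (herm (pd 1 v w) - \<i> *s herm (pd \<i> v w)))
      (dV v w - (row_col (herm (v w)) (dV v w) / row_col (herm (v w)) (v w)) *s v w))"
    unfolding dV_def
    by (intro c continuous_intros cv cpd) (simp_all add: row_col_herm_self nz)
  then show ?thesis
    by (rule continuous_on_eq) (simp add: J_def projP_eq_proj proj_mult_vec dV_def pd_herm dv)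
qed

lemma trace_tendsto_0:
  fixes F :: "complex option \<Rightarrow> (complex ^ 'n::finite) set"
  assumes F: "smooth_map_S2_CP F" and rep: "\<And>\<xi>. F (Some \<xi>) = cline (f \<xi>)"
    and P: "\<And>\<xi>. projP f differentiable (at \<xi>)"
  shows "((\<lambda>\<xi>. trace (dM (projP f) \<xi> ** dM (projP f) \<xi>)) \<longlongrightarrow> 0) at_infinity"
proof -
  define T where "T \<xi> = trace (dM (projP f) \<xi> ** dM (projP f) \<xi>)" for \<xi>
  obtain v V where V: "open V" "0 \<in> V" and v: "Ck_on 1 V v" and nzV: "\<forall>w\<in>V. v w \<noteq> 0"
    and eq: "\<forall>w\<in>V - {0}. projP v w = projP f (1 / w)"
    by (rule projP_smooth_at_infinity[OF F rep]) (rule that)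
  note nz = bspec[OF nzV]
  \<comment> \<open>The transformation law of a quadratic differential under
    \<open>w = 1 / \<xi>\<close>: each of the two derivatives of the projection contributes a factor
    \<open>- 1 / w\<^sup>2\<close>.\<close>
  have T: "w ^ 4 * (2 * J v w) = T (inverse w)" if w: "w \<in> V" "w \<noteq> 0" for w
  proof -
    have dv: "v differentiable (at w)"
      using v w by simp
    have "(projP v has_derivative (\<lambda>h. pd h (projP v) w)) (at w)"
      using has_derivative_projP[OF dv nz[OF w(1)]] has_derivative_pd differentiable_def by blast
    then have "((\<lambda>w. projP f (1 / w)) has_derivative (\<lambda>h. pd h (projP v) w)) (at w)"
      by (rule has_derivative_transform_within_open[where s = "V - {0}"]) (use V w eq in auto)
    then have "dM (projP v) w = dM (\<lambda>w. projP f (1 / w)) w"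
      unfolding dM_def by (simp add: pd_eqI)
    also have "\<dots> = (- 1 / w\<^sup>2) *\<^sub>M dM (projP f) (inverse w)"
      using dM_compose_inverse[OF w(2) P] by (simp add: divide_inverse)
    finally have "2 * J v w = (- 1 / w\<^sup>2) * ((- 1 / w\<^sup>2) * T (inverse w))"
      using trace_dM_projP[OF dv nz[OF w(1)]] by (simp only: scaleM_mult trace_scaleM T_def)
    then show ?thesis
      using w(2) by (simp add: field_simps flip: power_add)
  qed
  have "isCont (J v) 0"
    using continuous_on_J[OF v nz] V by (simp add: continuous_on_eq_continuous_at)
  then have "((\<lambda>w. w ^ 4 * (2 * J v w)) \<longlongrightarrow> 0 ^ 4 * (2 * J v 0)) (at 0)"
    by (intro tendsto_intros) (simp add: isCont_def)
  moreover have "eventually (\<lambda>w. w ^ 4 * (2 * J v w) = T (inverse w)) (at 0)"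
    unfolding eventually_at_topological using V T by blast
  ultimately have "((T \<circ> inverse) \<longlongrightarrow> 0) (at 0)"
    by (simp add: tendsto_cong o_def)
  then show ?thesis
    by (simp add: lim_at_infinity_0 T_def[abs_def])
qed

section \<open>The generalized Weierstrass surface\<close>

lemma hermM_simps:
  "hermM (A ** B) = hermM B ** hermM A" "hermM (A - B) = hermM A - hermM B"
  "hermM (A + B) = hermM A + hermM B" "hermM (c *\<^sub>M A) = cnj c *\<^sub>M hermM A"
  by (simp_all add: hermM_def vec_eq_iff matrix_matrix_mult_def scaleM_def mult.commute)

lemma trace_hermM: "trace (hermM A) = cnj (trace A)"
  by (simp add: trace_def hermM_def)

lemma hermM_commutator: "hermM (commutator A B) = - commutator (hermM A) (hermM B)"
  by (simp add: commutator_def hermM_simps)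

lemma hermM_pd_projP:
  assumes "projP f differentiable (at \<xi>)"
  shows "hermM (pd v (projP f) \<xi>) = pd v (projP f) \<xi>"
proof -
  have "(\<lambda>\<zeta>. hermM (projP f \<zeta>)) = projP f"
    by (simp add: projP_eq_proj hermM_proj fun_eq_iff)
  with pd_linear[OF bounded_linear_hermM assms, of v] show ?thesis
    by simp
qed

text \<open>The real partial derivatives of the projection are Hermitian, so conjugation only
  changes the sign of \<open>\<i>\<close>.\<close>

lemma dbarM_projP_eq_hermM:
  assumes "projP f differentiable (at \<xi>)"
  shows "dbarM (projP f) \<xi> = hermM (dM (projP f) \<xi>)"
  by (simp add: dM_eq dbarM_def hermM_simps hermM_pd_projP[OF assms])

lemma su_form_expand:
  "su_form (a *\<^sub>M A + b *\<^sub>M B) (a *\<^sub>M A + b *\<^sub>M B) =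
    a\<^sup>2 * su_form A A + 2 * su_form A B * a * b + b\<^sup>2 * su_form B B"
  by (simp add: su_form_def matrix_mult_linear_simps scaleM_mult trace_add trace_scaleM
      trace_mul_sym[of B A] power2_eq_square algebra_simps)

lemma su_form_scale: "su_form (c *\<^sub>M A) (c *\<^sub>M A) = c\<^sup>2 * su_form A A"
  by (simp add: su_form_def scaleM_mult trace_scaleM power2_eq_square)

text \<open>In real components the form has commutators of real derivatives as coefficients. Its
  closedness is then the divergence equation, and for \<open>P = projP f\<close> with
  \<open>Q = P \<xi>\<close> these coefficients are anti-Hermitian.\<close>

lemma weierstrass_form_real:
  fixes P :: "complex \<Rightarrow> complex ^ 'n::finite ^ 'n"
  shows "\<i> *\<^sub>M (- (h *\<^sub>M commutator (dM P \<xi>) Q) + cnj h *\<^sub>M commutator (dbarM P \<xi>) Q) =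
    Re h *\<^sub>R (- commutator (pd \<i> P \<xi>) Q) + Im h *\<^sub>R commutator (pd 1 P \<xi>) Q"
proof -
  define x y where "x = Re h" and "y = Im h"
  have h: "h = of_real x + \<i> * of_real y" "cnj h = of_real x - \<i> * of_real y"
    by (simp_all add: x_def y_def complex_eq_iff)
  have r: "r *\<^sub>R A = of_real r *\<^sub>M A" for r and A :: "complex ^ 'n ^ 'n"
    by (simp add: vec_eq_iff scaleM_def scaleR_conv_of_real[where 'a = complex])
  show ?thesis
    unfolding r x_def[symmetric] y_def[symmetric] h dM_def dbarM_def commutator_linear_simps
    by (simp add: vec_eq_iff scaleM_def field_simps)
qed

lemma weierstrass_surface_exists:
  fixes f :: "complex \<Rightarrow> complex ^ 'n::finite"
  assumes f: "Ck_on 2 UNIV f" and nz: "\<And>\<xi>. f \<xi> \<noteq> 0" and sol: "sigma_model_eq f"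
  shows "\<exists>X. weierstrass_surface f X"
proof -
  define C where "C v \<zeta> = commutator (pd v (projP f) \<zeta>) (projP f \<zeta>)" for v \<zeta>
  have CC: "Ck_on 1 UNIV (C v)" for v
    unfolding C_def[abs_def] by (rule Ck_on_pd_projP_commutator[OF f nz])
  then have dC: "C v differentiable (at \<xi>)" for v \<xi>
    by simp
  have "pd 1 (C 1) \<xi> + pd \<i> (C \<i>) \<xi> = 0" for \<xi>
    unfolding C_def[abs_def] by (rule sigma_model_divergence[OF f nz sol])
  then have "pd \<i> (\<lambda>\<zeta>. - C \<i> \<zeta>) \<xi> = pd 1 (C 1) \<xi>" for \<xi>
    unfolding pd_linear[OF bounded_linear_minus[OF bounded_linear_ident] dC]
    by (metis minus_unique add.commute)
  from closed_form_has_primitive[OF Ck_on_linear[OF bounded_linear_minus[OF bounded_linear_ident] CC] CC this]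
  obtain X where X0: "X 0 = 0"
    and X: "\<And>\<xi>. (X has_derivative (\<lambda>h. Re h *\<^sub>R (- C \<i> \<xi>) + Im h *\<^sub>R C 1 \<xi>)) (at \<xi>)"
    by blast
  have hC: "hermM (C v \<xi>) = - C v \<xi>" for v \<xi>
    unfolding C_def hermM_commutator hermM_pd_projP[OF projP_differentiable[OF f nz]]
    by (simp add: projP_eq_proj hermM_proj)
  \<comment> \<open>A linear map that kills the coefficients of the form is constant along
    \<open>X\<close>, and the constant is zero because \<open>X 0 = 0\<close>. Applied to the
    Hermitian part and to the trace, this places \<open>X\<close> in \<open>su\<close>.\<close>
  have vanish: "L (X \<xi>) = 0" if L: "bounded_linear L" and LC: "\<And>v \<xi>. L (C v \<xi>) = 0"
    for L :: "complex ^ 'n ^ 'n \<Rightarrow> 'b::real_normed_vector" and \<xi>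
  proof -
    interpret bounded_linear L by (rule L)
    have "((\<lambda>\<xi>. L (X \<xi>)) has_derivative (\<lambda>h. 0)) (at \<xi> within UNIV)" for \<xi>
      using bounded_linear.has_derivative[OF L X[of \<xi>]] by (simp add: add diff scaleR neg LC)
    from has_derivative_zero_constant[OF convex_UNIV this] obtain c where "\<And>\<xi>. L (X \<xi>) = c"
      by blast
    with X0 zero show ?thesis
      by metis
  qed
  have "hermM (X \<xi>) + X \<xi> = 0" for \<xi>
    by (rule vanish[OF bounded_linear_add[OF bounded_linear_hermM bounded_linear_ident]]) (simp add: hC)
  moreover have "trace (X \<xi>) = 0" for \<xi>
    by (rule vanish[OF bounded_linear_trace]) (simp add: C_def trace_commutator)
  ultimately have "X \<xi> \<in> su" for \<xi>
    by (simp add: su_def eq_neg_iff_add_eq_0)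
  with X show ?thesis
    unfolding weierstrass_surface_def weierstrass_form_real C_def by blast
qed

lemma weierstrass_surface_wirtinger:
  fixes f :: "complex \<Rightarrow> complex ^ 'n::finite"
  assumes "weierstrass_surface f X"
  shows "X differentiable (at \<xi>)"
    and "dM X \<xi> = (- \<i>) *\<^sub>M commutator (dM (projP f) \<xi>) (projP f \<xi>)"
    and "dbarM X \<xi> = \<i> *\<^sub>M commutator (dbarM (projP f) \<xi>) (projP f \<xi>)"
proof -
  have D: "(X has_derivative (\<lambda>h. \<i> *\<^sub>M
        (- (h *\<^sub>M commutator (dM (projP f) \<xi>) (projP f \<xi>)) +
         cnj h *\<^sub>M commutator (dbarM (projP f) \<xi>) (projP f \<xi>)))) (at \<xi>)"
    using assms by (simp add: weierstrass_surface_def)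
  then show "X differentiable (at \<xi>)"
    by (rule differentiableI)
  show "dM X \<xi> = (- \<i>) *\<^sub>M commutator (dM (projP f) \<xi>) (projP f \<xi>)"
    unfolding dM_def[of X] pd_eqI[OF D] by (simp add: vec_eq_iff scaleM_def algebra_simps)
  show "dbarM X \<xi> = \<i> *\<^sub>M commutator (dbarM (projP f) \<xi>) (projP f \<xi>)"
    unfolding dbarM_def[of X] pd_eqI[OF D] by (simp add: vec_eq_iff scaleM_def algebra_simps)
qed

section \<open>Vanishing of the quadratic differentials and conformality of the surface\<close>

theorem mainTheorem1:
  fixes f :: "complex \<Rightarrow> complex ^ 'n::finite"
    and F :: "complex option \<Rightarrow> (complex ^ 'n) set"
  assumes N_ge_2: "CARD('n) \<ge> 2"
    and F_smooth: "smooth_map_S2_CP F"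
    and f_smooth: "smooth_on UNIV f"
    and f_nonzero: "\<And>\<xi>. f \<xi> \<noteq> 0"
    and f_represents: "\<And>\<xi>. F (Some \<xi>) = cline (f \<xi>)"
    and solution: "sigma_model_eq f"
    and finite_action: "action f < \<infinity>"
  shows "(\<forall>\<xi>. J f \<xi> = 0 \<and> Jbar f \<xi> = 0) \<and>
    (\<exists>X. weierstrass_surface f X) \<and>
    (\<forall>X. weierstrass_surface f X \<longrightarrow> (\<forall>\<xi>.
       su_form (dM X \<xi>) (dM X \<xi>) = 0 \<and>
       su_form (dbarM X \<xi>) (dbarM X \<xi>) = 0 \<and>
       (\<forall>h. first_fundamental_form X \<xi> h =
              2 * su_form (dM X \<xi>) (dbarM X \<xi>) * h * cnj h)))"
proof -
  have f2: "Ck_on 2 UNIV f"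
    using f_smooth by (simp only: smooth_on_def)
  note dP = projP_differentiable[OF f2 f_nonzero] and PP = projP_idempotent[OF f_nonzero]
  have df: "f differentiable (at \<xi>)" for \<xi>
    using f2 by (simp add: numeral_2_eq_2)
  \<comment> \<open>Liouville: an entire function tending to 0 at infinity is zero.\<close>
  have T: "trace (dM (projP f) \<xi> ** dM (projP f) \<xi>) = 0" for \<xi>
    by (rule Liouville_weak_0[OF holomorphic_trace[OF f2 f_nonzero solution] trace_tendsto_0[OF F_smooth f_represents dP]])
  have Tbar: "trace (dbarM (projP f) \<xi> ** dbarM (projP f) \<xi>) = 0" for \<xi>
    unfolding dbarM_projP_eq_hermM[OF dP] hermM_simps[symmetric] trace_hermM T by simp
  have "J f \<xi> = 0 \<and> Jbar f \<xi> = 0" for \<xi>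
    using trace_dM_projP[OF df f_nonzero, of \<xi>] trace_dbarM_projP[OF df f_nonzero, of \<xi>]
    by (simp add: T Tbar)
  moreover have "\<exists>X. weierstrass_surface f X"
    by (rule weierstrass_surface_exists[OF f2 f_nonzero solution])
  moreover have "su_form (dM X \<xi>) (dM X \<xi>) = 0 \<and> su_form (dbarM X \<xi>) (dbarM X \<xi>) = 0 \<and>
       (\<forall>h. first_fundamental_form X \<xi> h = 2 * su_form (dM X \<xi>) (dbarM X \<xi>) * h * cnj h)"
    if X: "weierstrass_surface f X" for X \<xi>
  proof -
    note sq = trace_square_commutator[OF PP dM_projection(1)[OF dP PP]]
      trace_square_commutator[OF PP dM_projection(2)[OF dP PP]]
    \<comment> \<open>Both Wirtinger derivatives of \<open>X\<close> are commutators with the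
      projection up to a factor \<open>\<i>\<close> or \<open>- \<i>\<close>, so \<open>sq\<close>
      reduces their norms to the traces just shown to vanish.\<close>
    have conf: "su_form (dM X \<xi>) (dM X \<xi>) = 0" "su_form (dbarM X \<xi>) (dbarM X \<xi>) = 0"
      unfolding weierstrass_surface_wirtinger(2,3)[OF X] su_form_scale
      by (simp_all add: su_form_def sq T Tbar)
    \<comment> \<open>In the expansion along \<open>h\<close> and \<open>cnj h\<close> the pure
      squares carry the coefficients of \<open>conf\<close>; the mixed term alone remains.\<close>
    have "first_fundamental_form X \<xi> h = 2 * su_form (dM X \<xi>) (dbarM X \<xi>) * h * cnj h" for h
      unfolding first_fundamental_form_def pd_def[symmetric]
        pd_wirtinger[OF weierstrass_surface_wirtinger(1)[OF X]] su_form_expand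
      by (simp add: conf)
    with conf show ?thesis
      by blast
  qed
  ultimately show ?thesis
    by blast
qed

end
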